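(* Let $\tilde U_4=\{x\in\mathbb{R}^4 : Ax\ge b\}$ be the Klee–Walkup polyhedron, where $$A=\begin{pmatrix} -6 & -3 & 0 & 1\\ -3 & -6 & 1 & 0\\ -35 & -45 & 6 & 3\\ -45 & -35 & 3 & 6\\ 1&0&0&0\\0&1&0&0\\0&0&1&0\\0&0&0&1\end{pmatrix},\qquad b=(-1,-1,-8,-8,0,0,0,0)^T .$$ Let $P$ be any polyhedron combinatorially equivalent to $\tilde U_4$ (i.e. with face lattice isomorphic to that of $\tilde U_4$), given by any representation $P=\{x\in\mathbb{R}^n : A^1x=b^1,\ A^2x\ge b^2\}$ with $A^1,A^2$ rational matrices. Then the circuit diameter of $P$ with respect to this representation is at most $4$.
   Context: For a polyhedron $P=\{x\in\mathbb{R}^n : A^1x=b^1,\ A^2x\ge b^2\}$ with $A^i\in\mathbb{Q}^{d_i\times n}$, $b^i\in\mathbb{R}^{d_i}$, the set of circuits $\mathcal{C}(A^1,A^2)$ consists of the vectors $g\in\ker(A^1)\setminus\{0\}$ for which $A^2g$ is support-minimal in $\{A^2x : x\in\ker(A^1)\setminus\{0\}\}$, normalized to coprime integer components. For vertices $u,v$ of $P$, a circuit walk of length $k$ from $u$ to $v$ is a sequence $u=y^0,y^1,\dots,y^k=v$ such that for each $i=0,\dots,k-1$: $y^i\in P$; $y^{i+1}-y^i=\alpha_i g^i$ for some $g^i\in\mathcal{C}(A^1,A^2)$ and $\alpha_i>0$; and $y^i+\alpha g^i\notin P$ for all $\alpha>\alpha_i$ (each step goes maximally far). The circuit distance from $u$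 to $v$ is the minimum length of a circuit walk from $u$ to $v$ (not necessarily symmetric), and the circuit diameter of $P$ (with respect to the given representation) is the maximum circuit distance over all ordered pairs of vertices of $P$. The polyhedron $\tilde U_4$ is a 4-dimensional unbounded polyhedron with 8 facets whose graph (edge) diameter is 5. *)

theory Defs
  imports "HOL-Analysis.Analysis" "HOL-Library.Extended_Nat"
begin

text \<open>
  A matrix with \<open>n\<close> columns is the list of its rows, so that the number of rows is
  arbitrary and may be zero.  A pair \<open>A\<close>, \<open>b\<close> describes a linear system only if
  \<open>length b = length A\<close>.
\<close>

definition rational_rows :: "(real ^ 'n) list \<Rightarrow> bool" where
  "rational_rows A \<longleftrightarrow> (\<forall>a \<in> set A. \<forall>j. a $ j \<in> \<rat>)"

definition polyhedron_of ::
    "(real ^ 'n) list \<Rightarrow> real list \<Rightarrow> (real ^ 'n) list \<Rightarrow> real list \<Rightarrow> (real ^ 'n) set" where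
  "polyhedron_of A1 b1 A2 b2 =
     {x. (\<forall>i < length A1. A1 ! i \<bullet> x = b1 ! i) \<and> (\<forall>i < length A2. A2 ! i \<bullet> x \<ge> b2 ! i)}"

definition rows_kernel :: "(real ^ 'n) list \<Rightarrow> (real ^ 'n) set" where
  "rows_kernel A = {x. \<forall>i < length A. A ! i \<bullet> x = 0}"

text \<open>The support of the vector \<open>A x\<close>.\<close>

definition image_support :: "(real ^ 'n) list \<Rightarrow> real ^ 'n \<Rightarrow> nat set" where
  "image_support A x = {i. i < length A \<and> A ! i \<bullet> x \<noteq> 0}"

definition coprime_integer_vector :: "real ^ 'n \<Rightarrow> bool" where
  "coprime_integer_vector g \<longleftrightarrow>
     (\<exists>z :: 'n \<Rightarrow> int. (\<forall>j. g $ j = of_int (z j)) \<and> Gcd (range z) = 1)"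

definition circuits :: "(real ^ 'n) list \<Rightarrow> (real ^ 'n) list \<Rightarrow> (real ^ 'n) set" where
  "circuits A1 A2 =
     {g \<in> rows_kernel A1 - {0}.
        \<not> (\<exists>x \<in> rows_kernel A1 - {0}. image_support A2 x \<subset> image_support A2 g) \<and>
        coprime_integer_vector g}"

definition circuit_step ::
    "(real ^ 'n) list \<Rightarrow> real list \<Rightarrow> (real ^ 'n) list \<Rightarrow> real list \<Rightarrow>
     real ^ 'n \<Rightarrow> real ^ 'n \<Rightarrow> bool" where
  "circuit_step A1 b1 A2 b2 y y' \<longleftrightarrow>
     (\<exists>g \<in> circuits A1 A2. \<exists>\<alpha> > 0. y' - y = \<alpha> *\<^sub>R g \<and>
        (\<forall>\<beta> > \<alpha>. y + \<beta> *\<^sub>R g \<notin> polyhedron_of A1 b1 A2 b2))"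

definition circuit_walk ::
    "(real ^ 'n) list \<Rightarrow> real list \<Rightarrow> (real ^ 'n) list \<Rightarrow> real list \<Rightarrow>
     real ^ 'n \<Rightarrow> real ^ 'n \<Rightarrow> nat \<Rightarrow> (nat \<Rightarrow> real ^ 'n) \<Rightarrow> bool" where
  "circuit_walk A1 b1 A2 b2 u v k y \<longleftrightarrow>
     y 0 = u \<and> y k = v \<and>
     (\<forall>i < k. y i \<in> polyhedron_of A1 b1 A2 b2 \<and> circuit_step A1 b1 A2 b2 (y i) (y (Suc i)))"

text \<open>The distance is \<open>\<infinity>\<close> if there is no circuit walk.\<close>

definition circuit_distance ::
    "(real ^ 'n) list \<Rightarrow> real list \<Rightarrow> (real ^ 'n) list \<Rightarrow> real list \<Rightarrow>
     real ^ 'n \<Rightarrow> real ^ 'n \<Rightarrow> enat" where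
  "circuit_distance A1 b1 A2 b2 u v = Inf {enat k | k. \<exists>y. circuit_walk A1 b1 A2 b2 u v k y}"

text \<open>
  A polyhedron has only finitely many vertices, so the supremum is a maximum, except that it
  is \<open>0\<close> for a polyhedron without vertices.
\<close>

definition circuit_diameter ::
    "(real ^ 'n) list \<Rightarrow> real list \<Rightarrow> (real ^ 'n) list \<Rightarrow> real list \<Rightarrow> enat" where
  "circuit_diameter A1 b1 A2 b2 =
     Sup {circuit_distance A1 b1 A2 b2 u v | u v.
            u extreme_point_of polyhedron_of A1 b1 A2 b2 \<and>
            v extreme_point_of polyhedron_of A1 b1 A2 b2}"

text \<open>
  The face lattice consists of all faces, including the empty face and the polyhedron itself;
  the two polyhedra may lie in spaces of different dimensions.
\<close>

definition combinatorially_equivalent ::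
    "'a :: real_vector set \<Rightarrow> 'b :: real_vector set \<Rightarrow> bool" where
  "combinatorially_equivalent P Q \<longleftrightarrow>
     (\<exists>\<phi>. bij_betw \<phi> {F. F face_of P} {G. G face_of Q} \<and>
          (\<forall>F F'. F face_of P \<longrightarrow> F' face_of P \<longrightarrow> (F \<subseteq> F' \<longleftrightarrow> \<phi> F \<subseteq> \<phi> F')))"

definition klee_walkup_A :: "(real ^ 4) list" where
  "klee_walkup_A =
     [vector [ -6,  -3, 0, 1],
      vector [ -3,  -6, 1, 0],
      vector [-35, -45, 6, 3],
      vector [-45, -35, 3, 6],
      vector [1, 0, 0, 0],
      vector [0, 1, 0, 0],
      vector [0, 0, 1, 0],
      vector [0, 0, 0, 1]]"

definition klee_walkup_b :: "real list" where
  "klee_walkup_b = [-1, -1, -8, -8, 0, 0, 0, 0]"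

definition klee_walkup :: "(real ^ 4) set" where
  "klee_walkup = polyhedron_of [] [] klee_walkup_A klee_walkup_b"

end

theory Submission
  imports Defs
begin

text \<open>Nothing metric about \<open>P\<close> is given: right-hand sides may be irrational and
  rows redundant. Edge directions are nevertheless multiples of circuits, because up to scaling each
  is the only solution of a system with rational coefficients. The maximality of a step needs no
  step lengths: by the defining property of a face, a step that ends on a face not containing its
  start cannot be prolonged. Dimensions of faces transfer because strict inclusion of faces raises
  the dimension, while in a polyhedron with a vertex every nonempty face contains one of dimension
  one less; using this for the isomorphism and for its inverse gives equality. Calculation with
  numbers is confined to \<open>klee_walkup\<close>, which has fifteen vertices with exactly four
  tight rows each, so adjacency becomes a comparison of row lists.\<close>

text \<open>
  An edge direction of a polyhedron is a multiple of a circuit, so every edge walk is a circuit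
  walk, and circuit steps parallel to an edge may also start at points off that edge.  In the graph
  of the Klee-Walkup polyhedron only the vertices with tight rows \<open>{0,1,2,3}\<close> and \<open>{4,5,6,7}\<close> are at
  distance 5.  Both lie on an unbounded 2-face containing a vertex \<open>e\<close> at which a bounded edge \<open>E\<close>
  meets an unbounded edge \<open>R\<close>.  A step parallel to \<open>E\<close> ends on \<open>R\<close>, a second one along \<open>R\<close> ends at
  \<open>e\<close>, and from \<open>e\<close> the other vertex is two edges away.  All of this can be read off the face
  lattice, which determines the dimensions of the faces.
\<close>

section \<open>Circuit steps along edges\<close>

text \<open>Over the rationals, \<open>{1}\<close> is independent, so sending 1 to 1 extends to a
  linear map from the reals to \<open>rat\<close>; \<open>of_rat\<close> embeds its values back into
  the reals.\<close>

lemma rational_projection: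
  obtains \<rho> :: "real \<Rightarrow> real"
  where "\<And>x y. \<rho> (x + y) = \<rho> x + \<rho> y" and "\<And>q x. q \<in> \<rat> \<Longrightarrow> \<rho> (q * x) = q * \<rho> x"
    and "\<rho> 1 = 1" and "\<And>x. \<rho> x \<in> \<rat>"
proof -
  interpret vector_space_pair "\<lambda>(q::rat) (x::real). of_rat q * x" "\<lambda>(q::rat) (x::rat). q * x"
    by unfold_locales (simp_all add: algebra_simps of_rat_add of_rat_mult)
  have "vs1.independent {1}"
    by simp
  then obtain g where g: "Vector_Spaces.linear (\<lambda>(q::rat) (x::real). of_rat q * x) (\<lambda>(q::rat) (x::rat). q * x) g"
    and g1: "g 1 = 1"
    using linear_independent_extend[of "{1}" "\<lambda>_. 1"] by auto
  interpret g: Vector_Spaces.linear "\<lambda>(q::rat) (x::real). of_rat q * x" "\<lambda>(q::rat) (x::rat). q * x" g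
    by fact
  show thesis
  proof (rule that[of "of_rat \<circ> g"])
    show "(of_rat \<circ> g) (q * x) = q * (of_rat \<circ> g) x" if "q \<in> \<rat>" for q x :: real
      using that by (auto elim!: Rats_cases simp: g.scale of_rat_mult)
  qed (simp_all add: g.add of_rat_add g1)
qed

text \<open>
  The multiples of the circuits.  Minimality of the support is expressed as uniqueness up to
  scaling, which for a minimal support follows by eliminating one coordinate.
\<close>

definition circuit_direction :: "(real ^ 'n) list \<Rightarrow> (real ^ 'n) list \<Rightarrow> real ^ 'n \<Rightarrow> bool" where
  "circuit_direction A1 A2 g \<longleftrightarrow> g \<noteq> 0 \<and> g \<in> rows_kernel A1 \<and>
     (\<forall>x \<in> rows_kernel A1. image_support A2 x \<subseteq> image_support A2 g \<longrightarrow> (\<exists>c. x = c *\<^sub>R g))"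

section \<open>Positive multiples of circuit directions that are circuits\<close>

lemma image_support_scaleR: "c \<noteq> 0 \<Longrightarrow> image_support A (c *\<^sub>R x) = image_support A x"
  by (simp add: image_support_def)

lemma rows_kernel_scaleR: "x \<in> rows_kernel A \<Longrightarrow> c *\<^sub>R x \<in> rows_kernel A"
  by (simp add: rows_kernel_def)

lemma circuit_direction_scaleR:
  assumes "circuit_direction A1 A2 g" "c \<noteq> 0"
  shows "circuit_direction A1 A2 (c *\<^sub>R g)"
proof -
  have "\<exists>b. x = b *\<^sub>R c *\<^sub>R g" if "x = a *\<^sub>R g" for x a
    using that assms(2) by (intro exI[of _ "a / c"]) simp
  then show ?thesis
    using assms by (fastforce simp: circuit_direction_def image_support_scaleR rows_kernel_scaleR)
qed

text \<open>Clear denominators with their product, then divide by the gcd. The factor is positive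
  because the orientation of a step matters.\<close>

lemma rational_vector_multiple_coprime:
  fixes h :: "real ^ 'n"
  assumes rat: "\<And>i. h $ i \<in> \<rat>" and "h \<noteq> 0"
  obtains c where "c > 0" and "coprime_integer_vector (c *\<^sub>R h)"
proof -
  have "\<exists>n::nat. n > 0 \<and> of_nat n * h $ i \<in> \<int>" for i
  proof -
    obtain a b :: int where "b > 0" "h $ i = of_int a / of_int b"
      using rat[of i] by (metis Rats_cases')
    then have "of_nat (nat b) * h $ i = of_int a"
      by simp
    then show ?thesis
      using \<open>b > 0\<close> by (intro exI[of _ "nat b"]) simp
  qed
  then obtain N where N: "\<And>i. (N i :: nat) > 0" "\<And>i. of_nat (N i) * h $ i \<in> \<int>"
    by metis
  define M where "M = prod N UNIV"
  have "M > 0"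
    using N(1) by (simp add: M_def prod_pos)
  have "of_nat M * h $ i \<in> \<int>" for i
  proof -
    have "M = N i * prod N (UNIV - {i})"
      by (simp add: M_def prod.remove[of UNIV i])
    then have "of_nat M * h $ i = of_nat (prod N (UNIV - {i})) * (of_nat (N i) * h $ i)"
      by (simp add: mult_ac)
    then show ?thesis
      using N(2)[of i] by (metis Ints_mult Ints_of_nat)
  qed
  then have "\<exists>k. of_nat M * h $ i = of_int k" for i
    by (auto elim: Ints_cases)
  then obtain z where z: "\<And>i. of_nat M * h $ i = of_int (z i)"
    by metis
  define d where "d = Gcd (range z)"
  have "d \<noteq> 0"
  proof
    assume "d = 0"
    then have "\<And>i. z i = 0"
      by (auto simp: d_def)
    then have "h = 0"
      using z \<open>M > 0\<close> by (simp add: vec_eq_iff)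
    with \<open>h \<noteq> 0\<close> show False ..
  qed
  then have "d > 0"
    using Gcd_int_greater_eq_0[of "range z"] unfolding d_def by linarith
  define y where "y i = z i div d" for i
  have y: "z i = d * y i" for i
    by (simp add: y_def d_def)
  have "range z = (*) d ` range y"
    using y by auto
  then have "d = normalize (d * Gcd (range y))"
    unfolding d_def by (metis Gcd_mult)
  then have "Gcd (range y) = 1"
    using \<open>d > 0\<close> by simp
  moreover have "(of_nat M / of_int d) * h $ i = of_int (y i)" for i
    using z[of i] y[of i] \<open>d > 0\<close> by (simp add: field_simps)
  ultimately have "coprime_integer_vector ((of_nat M / of_int d) *\<^sub>R h)"
    unfolding coprime_integer_vector_def by (intro exI[of _ y]) simp
  moreover have "of_nat M / of_int d > (0::real)"
    using \<open>M > 0\<close> \<open>d > 0\<close> by simp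
  ultimately show thesis
    by (rule that[rotated])
qed

text \<open>
  Normalized by one coordinate, a circuit direction is the only solution of a linear system over
  the rationals; applying a \<open>\<rat>\<close>-linear projection of \<open>\<real>\<close> onto \<open>\<rat>\<close> to all coordinates produces
  a solution again.
\<close>

lemma circuit_direction_rational:
  fixes g :: "real ^ 'n"
  assumes "rational_rows A1" "rational_rows A2" and g: "circuit_direction A1 A2 g"
    and j: "g $ j = 1"
  shows "g $ i \<in> \<rat>"
proof -
  obtain \<rho> :: "real \<Rightarrow> real"
    where add: "\<And>x y. \<rho> (x + y) = \<rho> x + \<rho> y" and mult: "\<And>q x. q \<in> \<rat> \<Longrightarrow> \<rho> (q * x) = q * \<rho> x"
      and one: "\<rho> 1 = 1" and rat: "\<And>x. \<rho> x \<in> \<rat>"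
    using rational_projection by metis
  have zero: "\<rho> 0 = 0"
    using add[of 0 0] by simp
  define h :: "real ^ 'n" where "h = (\<chi> i. \<rho> (g $ i))"
  have sum: "\<rho> (sum f S) = (\<Sum>i\<in>S. \<rho> (f i))" if "finite S" for f and S :: "'n set"
    using that by (induction S) (simp_all add: zero add)
  have inner: "a \<bullet> h = \<rho> (a \<bullet> g)" if "\<And>j. a $ j \<in> \<rat>" for a
    using that by (simp add: inner_vec_def h_def sum mult)
  have inner1: "A1 ! i \<bullet> h = \<rho> (A1 ! i \<bullet> g)" if "i < length A1" for i
    using that \<open>rational_rows A1\<close> by (intro inner) (auto simp: rational_rows_def)
  have inner2: "A2 ! i \<bullet> h = \<rho> (A2 ! i \<bullet> g)" if "i < length A2" for i
    using that \<open>rational_rows A2\<close> by (intro inner) (auto simp: rational_rows_def)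
  have "h \<in> rows_kernel A1"
    using g inner1 by (simp add: circuit_direction_def rows_kernel_def zero)
  moreover have "image_support A2 h \<subseteq> image_support A2 g"
    using inner2 by (auto simp: image_support_def zero)
  ultimately obtain c where c: "h = c *\<^sub>R g"
    using g by (auto simp: circuit_direction_def)
  have "h $ j = 1"
    by (simp add: h_def j one)
  with c j have "h = g"
    by simp
  then show ?thesis
    using rat by (metis h_def vec_lambda_beta)
qed

lemma circuit_direction_multiple_in_circuits:
  assumes "rational_rows A1" "rational_rows A2" and g: "circuit_direction A1 A2 g"
  obtains c where "c > 0" and "c *\<^sub>R g \<in> circuits A1 A2"
proof -
  obtain j where j: "g $ j \<noteq> 0"
    using g by (auto simp: circuit_direction_def vec_eq_iff)
  \<comment> \<open>Dividing by the absolute value keeps the orientation of \<open>g\<close>.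
    Rationality is known when the coordinate is 1, so it is transferred up to sign.\<close>
  define h where "h = (1 / \<bar>g $ j\<bar>) *\<^sub>R g"
  have rat: "h $ i \<in> \<rat>" for i
  proof -
    have "((1 / g $ j) *\<^sub>R g) $ i \<in> \<rat>"
      using j by (intro circuit_direction_rational[OF assms(1,2), of _ j] circuit_direction_scaleR[OF g]) simp_all
    then show ?thesis
      by (cases "g $ j > 0") (simp_all add: h_def)
  qed
  have "h \<noteq> 0"
    using g j by (simp add: h_def circuit_direction_def)
  then obtain b where b: "b > 0" "coprime_integer_vector (b *\<^sub>R h)"
    using rational_vector_multiple_coprime rat by metis
  define c where "c = b / \<bar>g $ j\<bar>"
  have "c > 0"
    using b j by (simp add: c_def)
  have coprime: "coprime_integer_vector (c *\<^sub>R g)"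
    using b by (simp add: c_def h_def)
  have dir: "circuit_direction A1 A2 (c *\<^sub>R g)"
    using circuit_direction_scaleR[OF g] \<open>c > 0\<close> by simp
  have "\<not> image_support A2 x \<subset> image_support A2 (c *\<^sub>R g)" if x: "x \<in> rows_kernel A1 - {0}" for x
  proof
    assume less: "image_support A2 x \<subset> image_support A2 (c *\<^sub>R g)"
    then obtain a where a: "x = a *\<^sub>R c *\<^sub>R g"
      using x dir unfolding circuit_direction_def by blast
    then have "a \<noteq> 0"
      using x by auto
    then show False
      using less a image_support_scaleR by blast
  qed
  then have "c *\<^sub>R g \<in> circuits A1 A2"
    using dir coprime unfolding circuits_def circuit_direction_def by blast
  with \<open>c > 0\<close> show thesis
    by (rule that)
qed

text \<open>A feasible point beyond \<open>y'\<close> would put \<open>y'\<close>, a point of the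
  face \<open>G\<close>, strictly between two points of the polyhedron. Then \<open>y\<close> would
  lie in \<open>G\<close> as well.\<close>

lemma circuit_stepI:
  assumes "rational_rows A1" "rational_rows A2" and dir: "circuit_direction A1 A2 (y' - y)"
    and y: "y \<in> polyhedron_of A1 b1 A2 b2" and G: "G face_of polyhedron_of A1 b1 A2 b2"
    and "y' \<in> G" "y \<notin> G"
  shows "circuit_step A1 b1 A2 b2 y y'"
proof -
  obtain c where "c > 0" and c: "c *\<^sub>R (y' - y) \<in> circuits A1 A2"
    using circuit_direction_multiple_in_circuits[OF assms(1-3)] by metis
  have "y + \<beta> *\<^sub>R c *\<^sub>R (y' - y) \<notin> polyhedron_of A1 b1 A2 b2" if "\<beta> > 1 / c" for \<beta>
  proof
    define z where "z = y + \<beta> *\<^sub>R c *\<^sub>R (y' - y)"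
    assume "y + \<beta> *\<^sub>R c *\<^sub>R (y' - y) \<in> polyhedron_of A1 b1 A2 b2"
    then have z: "z \<in> polyhedron_of A1 b1 A2 b2"
      by (simp add: z_def)
    have bc: "\<beta> * c > 1"
      using that \<open>c > 0\<close> by (simp add: field_simps)
    \<comment> \<open>The parameter at which the segment from \<open>y\<close> to the supposed
      farther point \<open>z\<close> passes through \<open>y'\<close>.\<close>
    define t where "t = 1 / (\<beta> * c)"
    have t: "0 < t" "t < 1" and tbc: "t * (\<beta> * c) = 1"
      using bc by (auto simp: t_def)
    have "(1 - t) *\<^sub>R y + t *\<^sub>R z = y + (t * (\<beta> * c)) *\<^sub>R (y' - y)"
      by (simp add: z_def algebra_simps)
    also have "\<dots> = y'"
      unfolding tbc by simp
    finally have y'eq: "y' = (1 - t) *\<^sub>R y + t *\<^sub>R z" ..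
    have "y' \<noteq> y"
      using \<open>y' \<in> G\<close> \<open>y \<notin> G\<close> by auto
    then have "y \<noteq> z"
      using bc by (auto simp: z_def)
    then have "y' \<in> open_segment y z"
      using t y'eq by (auto simp: in_segment)
    then show False
      using face_ofD[OF G _ y z] \<open>y' \<in> G\<close> \<open>y \<notin> G\<close> by blast
  qed
  then show ?thesis
    unfolding circuit_step_def using c \<open>c > 0\<close> by (intro bexI[OF _ c] exI[of _ "1 / c"]) simp
qed

section \<open>Edges give circuit directions\<close>

lemma aff_dim_le_1_parallel:
  fixes G :: "'a::euclidean_space set"
  assumes "aff_dim G \<le> 1" "u \<in> G" "v \<in> G" "u \<noteq> v" "p \<in> G" "q \<in> G"
  obtains c where "q - p = c *\<^sub>R (v - u)"
proof -
  obtain w where w: "\<And>x y. x \<in> G \<Longrightarrow> y \<in> G \<Longrightarrow> \<exists>c. x - y = c *\<^sub>R w"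
    using assms(1) unfolding collinear_aff_dim[symmetric] collinear_def by blast
  obtain a where a: "v - u = a *\<^sub>R w"
    using w assms by blast
  obtain b where b: "q - p = b *\<^sub>R w"
    using w assms by blast
  have "a \<noteq> 0"
    using a \<open>u \<noteq> v\<close> by auto
  then have "q - p = (b / a) *\<^sub>R (v - u)"
    by (simp add: a b)
  then show thesis
    by (rule that)
qed

text \<open>Tight rows do not change along \<open>x\<close>, and the finitely many slack rows
  tolerate a small move in either direction.\<close>

lemma polyhedron_of_perturbation:
  assumes m: "m \<in> polyhedron_of A1 b1 A2 b2" and x: "x \<in> rows_kernel A1"
    and tight: "\<And>i. i < length A2 \<Longrightarrow> A2 ! i \<bullet> m = b2 ! i \<Longrightarrow> A2 ! i \<bullet> x = 0"
  obtains \<epsilon> where "\<epsilon> > 0" and "\<And>\<delta>. \<bar>\<delta>\<bar> = \<epsilon> \<Longrightarrow> m + \<delta> *\<^sub>R x \<in> polyhedron_of A1 b1 A2 b2"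
proof -
  have ex: "\<exists>\<epsilon>>0. \<forall>\<delta>. \<bar>\<delta>\<bar> \<le> \<epsilon> \<longrightarrow> \<bar>\<delta> * (A2 ! i \<bullet> x)\<bar> \<le> A2 ! i \<bullet> m - b2 ! i"
    if i: "i < length A2" for i
  proof (cases "A2 ! i \<bullet> x = 0")
    case True
    then show ?thesis
      using m i by (intro exI[of _ 1]) (simp add: polyhedron_of_def)
  next
    case False
    then have "A2 ! i \<bullet> m - b2 ! i > 0"
      using m tight[OF i] i by (fastforce simp: polyhedron_of_def)
    then show ?thesis
      using False
      by (intro exI[of _ "(A2 ! i \<bullet> m - b2 ! i) / \<bar>A2 ! i \<bullet> x\<bar>"]) (simp add: abs_mult field_simps)
  qed
  obtain \<epsilon> where \<epsilon>: "\<And>i. i < length A2 \<Longrightarrow> \<epsilon> i > 0 \<and>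
      (\<forall>\<delta>. \<bar>\<delta>\<bar> \<le> \<epsilon> i \<longrightarrow> \<bar>\<delta> * (A2 ! i \<bullet> x)\<bar> \<le> A2 ! i \<bullet> m - b2 ! i)"
    using ex by metis
  \<comment> \<open>The inserted \<open>1\<close> keeps the set nonempty when \<open>A2\<close> has
    no rows.\<close>
  define \<epsilon>0 where "\<epsilon>0 = Min (insert 1 (\<epsilon> ` {..<length A2}))"
  have "\<epsilon>0 > 0"
    using \<epsilon> by (simp add: \<epsilon>0_def)
  moreover have "m + \<delta> *\<^sub>R x \<in> polyhedron_of A1 b1 A2 b2" if "\<bar>\<delta>\<bar> = \<epsilon>0" for \<delta>
  proof -
    have "A2 ! i \<bullet> (m + \<delta> *\<^sub>R x) \<ge> b2 ! i" if i: "i < length A2" for i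
    proof -
      have "\<epsilon>0 \<le> \<epsilon> i"
        using i by (simp add: \<epsilon>0_def)
      then have "\<bar>\<delta> * (A2 ! i \<bullet> x)\<bar> \<le> A2 ! i \<bullet> m - b2 ! i"
        using \<epsilon>[OF i] \<open>\<bar>\<delta>\<bar> = \<epsilon>0\<close> by simp
      then show ?thesis
        by (simp add: inner_add_right abs_if split: if_splits)
    qed
    then show ?thesis
      using m x by (simp add: polyhedron_of_def rows_kernel_def inner_add_right)
  qed
  ultimately show thesis
    by (rule that)
qed

text \<open>A competitor \<open>x\<close> with support inside that of \<open>v - u\<close> vanishes
  on all rows tight at the midpoint of \<open>u\<close> and \<open>v\<close>. Moving from there both
  ways along \<open>x\<close> stays feasible, hence stays in the face \<open>G\<close>, which has
  only one direction.\<close>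

lemma circuit_direction_edge:
  assumes G: "G face_of polyhedron_of A1 b1 A2 b2" and dim: "aff_dim G \<le> 1"
    and uv: "u \<in> G" "v \<in> G" "u \<noteq> v"
  shows "circuit_direction A1 A2 (v - u)"
proof -
  define P where "P = polyhedron_of A1 b1 A2 b2"
  have "u \<in> P" "v \<in> P"
    using G uv face_of_imp_subset unfolding P_def by blast+
  \<comment> \<open>A row tight at the midpoint is tight at both \<open>u\<close> and
    \<open>v\<close>, hence zero on \<open>v - u\<close>.\<close>
  define m where "m = (1/2) *\<^sub>R u + (1/2) *\<^sub>R v"
  have "m \<in> G"
    using face_of_imp_convex[OF G] uv by (simp add: m_def convex_def)
  have "v - u \<in> rows_kernel A1"
    using \<open>u \<in> P\<close> \<open>v \<in> P\<close> by (simp add: P_def polyhedron_of_def rows_kernel_def inner_diff_right)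
  moreover have "\<exists>c. x = c *\<^sub>R (v - u)"
    if x: "x \<in> rows_kernel A1" and supp: "image_support A2 x \<subseteq> image_support A2 (v - u)" for x
  proof (cases "x = 0")
    case False
    have tight: "A2 ! i \<bullet> x = 0" if "i < length A2" "A2 ! i \<bullet> m = b2 ! i" for i
    proof (rule ccontr)
      assume "A2 ! i \<bullet> x \<noteq> 0"
      then have "i \<in> image_support A2 (v - u)"
        using that supp by (auto simp: image_support_def)
      then have neq: "A2 ! i \<bullet> u \<noteq> A2 ! i \<bullet> v"
        by (simp add: image_support_def inner_diff_right)
      have "A2 ! i \<bullet> u \<ge> b2 ! i" "A2 ! i \<bullet> v \<ge> b2 ! i"
        using \<open>u \<in> P\<close> \<open>v \<in> P\<close> that by (simp_all add: P_def polyhedron_of_def)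
      moreover have "(A2 ! i \<bullet> u + A2 ! i \<bullet> v) / 2 = b2 ! i"
        using that by (simp add: m_def inner_add_right)
      ultimately have "A2 ! i \<bullet> u = b2 ! i" "A2 ! i \<bullet> v = b2 ! i"
        by (simp_all add: field_simps)
      with neq show False
        by simp
    qed
    have "m \<in> P"
      using \<open>m \<in> G\<close> G face_of_imp_subset unfolding P_def by blast
    then obtain \<epsilon> where "\<epsilon> > 0" and in_P: "\<And>\<delta>. \<bar>\<delta>\<bar> = \<epsilon> \<Longrightarrow> m + \<delta> *\<^sub>R x \<in> P"
      unfolding P_def using polyhedron_of_perturbation[OF _ x tight] by metis
    have "m \<in> open_segment (m + \<epsilon> *\<^sub>R x) (m + (- \<epsilon>) *\<^sub>R x)"
      using \<open>\<epsilon> > 0\<close> False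
      by (auto simp: in_segment algebra_simps simp flip: scaleR_left.add intro!: exI[of _ "1/2"])
    then have "m + \<epsilon> *\<^sub>R x \<in> G"
      using face_ofD[OF G[folded P_def] _ in_P[of \<epsilon>] in_P[of "- \<epsilon>"] \<open>m \<in> G\<close>] \<open>\<epsilon> > 0\<close> by simp
    then obtain c where "(m + \<epsilon> *\<^sub>R x) - m = c *\<^sub>R (v - u)"
      using aff_dim_le_1_parallel[OF dim uv \<open>m \<in> G\<close>] by metis
    then have "x = (c / \<epsilon>) *\<^sub>R (v - u)"
      using \<open>\<epsilon> > 0\<close> by (simp add: eq_vector_fraction_iff)
    then show ?thesis ..
  qed auto
  ultimately show ?thesis
    using \<open>u \<noteq> v\<close> by (simp add: circuit_direction_def)
qed

lemma circuit_distance_le: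
  assumes "(u, v) \<in> {(y, y'). y \<in> polyhedron_of A1 b1 A2 b2 \<and> circuit_step A1 b1 A2 b2 y y'} ^^ k"
  shows "circuit_distance A1 b1 A2 b2 u v \<le> enat k"
proof -
  obtain y where "circuit_walk A1 b1 A2 b2 u v k y"
    using assms unfolding relpow_fun_conv circuit_walk_def by auto
  then show ?thesis
    unfolding circuit_distance_def by (intro Inf_lower) auto
qed

section \<open>Faces of pointed polyhedra\<close>

lemma polyhedron_polyhedron_of: "polyhedron (polyhedron_of A1 b1 A2 b2)"
proof -
  have "polyhedron_of A1 b1 A2 b2 =
      (\<Inter>i<length A1. {x. A1 ! i \<bullet> x = b1 ! i}) \<inter> (\<Inter>i<length A2. {x. A2 ! i \<bullet> x \<ge> b2 ! i})"
    by (auto simp: polyhedron_of_def)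
  also have "polyhedron \<dots>"
    by (intro polyhedron_Int polyhedron_Inter)
      (auto intro: polyhedron_hyperplane polyhedron_halfspace_ge)
  finally show ?thesis .
qed

text \<open>A line through any point \<open>p\<close> forces every row to vanish on
  \<open>d\<close>; the same line through \<open>u\<close> would then be feasible, contradicting
  that \<open>u\<close> is extreme.\<close>

lemma polyhedron_of_no_line:
  assumes u: "u extreme_point_of polyhedron_of A1 b1 A2 b2" and "d \<noteq> 0"
  obtains t where "p + t *\<^sub>R d \<notin> polyhedron_of A1 b1 A2 b2"
proof (rule ccontr)
  assume "\<not> thesis"
  then have line: "p + t *\<^sub>R d \<in> polyhedron_of A1 b1 A2 b2" for t
    using that by blast
  have A1: "A1 ! i \<bullet> d = 0" if "i < length A1" for i
  proof -
    have "A1 ! i \<bullet> p + t * (A1 ! i \<bullet> d) = b1 ! i" for t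
      using line[of t] that by (simp add: polyhedron_of_def inner_add_right)
    from this[of 0] this[of 1] show ?thesis by simp
  qed
  have A2: "A2 ! i \<bullet> d = 0" if "i < length A2" for i
  proof (rule ccontr)
    assume nz: "A2 ! i \<bullet> d \<noteq> 0"
    have "A2 ! i \<bullet> p + t * (A2 ! i \<bullet> d) \<ge> b2 ! i" for t
      using line[of t] that by (simp add: polyhedron_of_def inner_add_right)
    \<comment> \<open>At this parameter the row would take the value
      \<open>b2 ! i - 1\<close>.\<close>
    from this[of "(b2 ! i - A2 ! i \<bullet> p - 1) / (A2 ! i \<bullet> d)"] nz show False by simp
  qed
  have uP: "u \<in> polyhedron_of A1 b1 A2 b2"
    using u by (simp add: extreme_point_of_def)
  have "u + t *\<^sub>R d \<in> polyhedron_of A1 b1 A2 b2" for t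
    using uP A1 A2 by (simp add: polyhedron_of_def inner_add_right)
  from this[of 1] this[of "-1"]
  have "u + d \<in> polyhedron_of A1 b1 A2 b2" "u - d \<in> polyhedron_of A1 b1 A2 b2"
    by simp_all
  moreover have "u \<in> open_segment (u + d) (u - d)"
  proof -
    have "(u + d) - (u - d) = 2 *\<^sub>R d" "midpoint (u + d) (u - d) = u"
      by (simp_all add: midpoint_def flip: scaleR_2)
    then show ?thesis
      using \<open>d \<noteq> 0\<close> midpoint_in_open_segment[of "u + d" "u - d"] by auto
  qed
  ultimately show False
    using u unfolding extreme_point_of_def by blast
qed

text \<open>A facet of \<open>F\<close> serves if there is one. Otherwise the relative frontier of
  \<open>F\<close> is empty, so \<open>F\<close> is affine; containing no line, it is a point, and
  the empty face of dimension -1 lies one below.\<close>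

lemma polyhedron_of_face_codim_1:
  assumes u: "u extreme_point_of polyhedron_of A1 b1 A2 b2"
    and F: "F face_of polyhedron_of A1 b1 A2 b2" and "F \<noteq> {}"
  obtains F' where "F' face_of polyhedron_of A1 b1 A2 b2" "F' \<subset> F" "aff_dim F' = aff_dim F - 1"
proof (cases "\<exists>F'. F' facet_of F")
  case True
  then obtain F' where F': "F' facet_of F" ..
  then have "F' face_of F" "aff_dim F' = aff_dim F - 1"
    by (simp_all add: facet_of_def)
  moreover from this have "F' face_of polyhedron_of A1 b1 A2 b2" "F' \<subset> F"
    using face_of_trans[OF _ F] face_of_imp_subset[of F' F] by auto
  ultimately show ?thesis
    using that by blast
next
  case False
  have "polyhedron F"
    using F polyhedron_polyhedron_of face_of_polyhedron_polyhedron by blast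
  then have "affine F"
    using False by (simp add: rel_frontier_of_polyhedron flip: rel_frontier_eq_empty)
  obtain p where "p \<in> F"
    using \<open>F \<noteq> {}\<close> by blast
  have "q = p" if "q \<in> F" for q
  proof (rule ccontr)
    assume "q \<noteq> p"
    then obtain t where t: "p + t *\<^sub>R (q - p) \<notin> polyhedron_of A1 b1 A2 b2"
      using polyhedron_of_no_line[OF u, of "q - p"] by auto
    have "(1 - t) *\<^sub>R p + t *\<^sub>R q \<in> F"
      using \<open>affine F\<close> \<open>p \<in> F\<close> that unfolding affine_def by auto
    then have "p + t *\<^sub>R (q - p) \<in> F"
      by (simp add: algebra_simps)
    with t F show False
      using face_of_imp_subset by blast
  qed
  then have "F = {p}"
    using \<open>p \<in> F\<close> by blast
  then show ?thesis
    using that[of "{}"] by auto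
qed

text \<open>A pointed polyhedron has a chain of faces through all dimensions, starting at the empty face.\<close>

lemma aff_dim_le_of_face_embedding:
  fixes Q :: "'a::euclidean_space set"
  assumes u: "u extreme_point_of polyhedron_of A1 b1 A2 b2" and "convex Q"
    and face: "\<And>F. F face_of polyhedron_of A1 b1 A2 b2 \<Longrightarrow> \<phi> F face_of Q"
    and mono: "\<And>F F'. F face_of polyhedron_of A1 b1 A2 b2 \<Longrightarrow> F' face_of polyhedron_of A1 b1 A2 b2 \<Longrightarrow>
      F \<subset> F' \<Longrightarrow> \<phi> F \<subset> \<phi> F'"
    and F: "F face_of polyhedron_of A1 b1 A2 b2"
  shows "aff_dim F \<le> aff_dim (\<phi> F)"
  using F
\<comment> \<open>The shift by one makes the empty face, of dimension -1, the base case.\<close>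
proof (induction "nat (aff_dim F + 1)" arbitrary: F)
  case 0
  then have "aff_dim F \<le> -1"
    by simp
  then show ?case
    using aff_dim_geq[of "\<phi> F"] by linarith
next
  case (Suc n)
  then have "F \<noteq> {}"
    by auto
  then obtain F' where F': "F' face_of polyhedron_of A1 b1 A2 b2" "F' \<subset> F" "aff_dim F' = aff_dim F - 1"
    using polyhedron_of_face_codim_1[OF u Suc.prems] by blast
  have "aff_dim F' \<le> aff_dim (\<phi> F')"
    using Suc.hyps F' by (intro Suc.hyps(1)) auto
  also have "\<dots> < aff_dim (\<phi> F)"
  proof (rule face_of_aff_dim_lt)
    have "\<phi> F' \<subset> \<phi> F"
      using mono F' Suc.prems by blast
    then show "\<phi> F' face_of \<phi> F" "\<phi> F' \<noteq> \<phi> F"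
      using face_of_subset[OF face[OF F'(1)]] face_of_imp_subset[OF face[OF Suc.prems]] by auto
    show "convex (\<phi> F)"
      using face[OF Suc.prems] face_of_imp_convex by blast
  qed
  finally show ?case
    using F'(3) by linarith
qed

text \<open>If the ray left \<open>R\<close>, the set \<open>T\<close> of its parameters in
  \<open>R\<close> would be bounded, and the point at its largest parameter would be extreme. That
  point lies at or beyond \<open>w\<close>, so it is a second extreme point.\<close>

lemma edge_with_one_vertex_unbounded:
  fixes P :: "'a::euclidean_space set"
  assumes P: "convex P" "closed P" and R: "R face_of P" "aff_dim R \<le> 1"
    and e: "e \<in> R" and w: "w \<in> R" "w \<noteq> e"
    and unique: "\<And>x. x \<in> R \<Longrightarrow> x extreme_point_of P \<Longrightarrow> x = e"
    and "s \<ge> 0"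
  shows "e + s *\<^sub>R (w - e) \<in> R"
proof (rule ccontr)
  assume s: "e + s *\<^sub>R (w - e) \<notin> R"
  define T where "T = {t. e + t *\<^sub>R (w - e) \<in> R}"
  have "closed R" "convex R"
    using P R face_of_imp_closed face_of_imp_convex by blast+
  have "closed T"
  proof -
    have "T = (\<lambda>t. e + t *\<^sub>R (w - e)) -` R"
      by (auto simp: T_def)
    then show ?thesis
      using \<open>closed R\<close> by (simp add: closed_vimage continuous_intros)
  qed
  have "0 \<in> T" "1 \<in> T"
    using e w by (simp_all add: T_def)
  have "t \<le> s" if "t \<in> T" for t
  proof (rule ccontr)
    assume "\<not> t \<le> s"
    then have "(1 - s / t) *\<^sub>R e + (s / t) *\<^sub>R (e + t *\<^sub>R (w - e)) \<in> R"
      using \<open>convex R\<close> e that \<open>s \<ge> 0\<close> unfolding convex_alt T_def by simp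
    also have "(1 - s / t) *\<^sub>R e + (s / t) *\<^sub>R (e + t *\<^sub>R (w - e)) = e + s *\<^sub>R (w - e)"
      using \<open>\<not> t \<le> s\<close> \<open>s \<ge> 0\<close> by (simp add: algebra_simps)
    finally show False
      using s by simp
  qed
  then have bdd: "bdd_above T"
    by (auto simp: bdd_above_def)
  define m where "m = Sup T"
  have "m \<in> T"
    unfolding m_def using \<open>closed T\<close> \<open>0 \<in> T\<close> bdd by (intro closed_contains_Sup) auto
  have le: "t \<le> m" if "t \<in> T" for t
    using cSup_upper[OF that bdd] by (simp add: m_def)
  define z where "z = e + m *\<^sub>R (w - e)"
  have "z extreme_point_of R"
    unfolding extreme_point_of_def
  proof (intro conjI ballI notI)
    show "z \<in> R"
      using \<open>m \<in> T\<close> by (simp add: T_def z_def)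
    fix p q assume pq: "p \<in> R" "q \<in> R" and "z \<in> open_segment p q"
    obtain a where a: "p - e = a *\<^sub>R (w - e)"
      using aff_dim_le_1_parallel[OF R(2) e w(1) w(2)[symmetric] e pq(1)] by metis
    obtain b where b: "q - e = b *\<^sub>R (w - e)"
      using aff_dim_le_1_parallel[OF R(2) e w(1) w(2)[symmetric] e pq(2)] by metis
    have p: "p = e + a *\<^sub>R (w - e)" and q: "q = e + b *\<^sub>R (w - e)"
      using a b by (simp_all add: algebra_simps)
    have ab: "a \<le> m" "b \<le> m"
      using pq p q by (auto intro!: le simp: T_def)
    obtain c where c: "0 < c" "c < 1" "z = (1 - c) *\<^sub>R p + c *\<^sub>R q" "p \<noteq> q"
      using \<open>z \<in> open_segment p q\<close> by (auto simp: in_segment)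
    have "m *\<^sub>R (w - e) = ((1 - c) * a + c * b) *\<^sub>R (w - e)"
      using c(3) unfolding z_def p q by (simp add: algebra_simps)
    then have "m = (1 - c) * a + c * b"
      using w by simp
    \<comment> \<open>Both summands are nonnegative, so \<open>a\<close> and \<open>b\<close> both
      equal \<open>m\<close>, against \<open>p \<noteq> q\<close>.\<close>
    then have "(1 - c) * (m - a) + c * (m - b) = 0"
      by (simp add: algebra_simps)
    moreover have "(1 - c) * (m - a) \<ge> 0" "c * (m - b) \<ge> 0"
      using c ab by simp_all
    ultimately have "(1 - c) * (m - a) = 0" "c * (m - b) = 0"
      by linarith+
    then have "a = b"
      using c by simp
    then show False
      using c p q by simp
  qed
  then have "z = e"
    using unique extreme_point_of_face[OF R(1)] by blast
  then have "m = 0"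
    using w by (simp add: z_def)
  then show False
    using le[OF \<open>1 \<in> T\<close>] by simp
qed

text \<open>If \<open>a - e\<close> were outside the span, three independent differences of points
  of \<open>F\<close> would force dimension at least 3.\<close>

lemma aff_dim_le_2_combination:
  fixes F :: "'a::euclidean_space set"
  assumes dim: "aff_dim F \<le> 2" and F: "e \<in> F" "d \<in> F" "w \<in> F" "a \<in> F"
    and indep: "w \<noteq> e" "d - e \<notin> span {w - e}"
  obtains x s where "a - e = x *\<^sub>R (d - e) + s *\<^sub>R (w - e)"
proof -
  have "a - e \<in> span {d - e, w - e}"
  proof (rule ccontr)
    assume a: "a - e \<notin> span {d - e, w - e}"
    define B where "B = {a - e, d - e, w - e}"
    have "independent {w - e}"
      using indep by simp
    then have "independent B"
      unfolding B_def using indep(2) a by (simp add: independent_insertI)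
    then have "card B \<le> dim ((\<lambda>x. x - e) ` F)"
      using F by (intro independent_card_le_dim) (auto simp: B_def)
    moreover have "card B = 3"
    proof -
      have "d - e \<noteq> w - e" "a - e \<noteq> d - e" "a - e \<noteq> w - e"
        using indep(2) a by (metis span_base insertI1 insertI2)+
      then show ?thesis
        by (simp add: B_def)
    qed
    ultimately show False
      using dim aff_dim_eq_dim_subtract[OF hull_inc[OF F(1)]] by simp
  qed
  then obtain x s where "a - e - x *\<^sub>R (d - e) = s *\<^sub>R (w - e)"
    by (auto simp: span_breakdown_eq[of _ "d - e"] span_singleton)
  then have "a - e = x *\<^sub>R (d - e) + s *\<^sub>R (w - e)"
    by (simp add: algebra_simps)
  then show thesis
    by (rule that)
qed

text \<open>
  In the plane of \<open>F\<close>, with axes along \<open>E\<close> and \<open>R\<close> and origin \<open>e\<close>, the point \<open>a\<close> has positive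
  coordinates.  Since \<open>R\<close> is unbounded, the step parallel to \<open>E\<close> cannot miss it.
\<close>

lemma two_steps_via_unbounded_edge:
  assumes rat: "rational_rows A1" "rational_rows A2"
    and P: "P = polyhedron_of A1 b1 A2 b2"
    and F: "F \<subseteq> P" "aff_dim F \<le> 2"
    and E: "E face_of P" "E \<subseteq> F" "aff_dim E \<le> 1" and R: "R face_of P" "R \<subseteq> F" "aff_dim R \<le> 1"
    and e: "e \<in> E" "e \<in> R" "e extreme_point_of P" and d: "d \<in> E" "d \<notin> R" and w: "w \<in> R" "w \<notin> E"
    and ray: "\<And>s. s \<ge> 0 \<Longrightarrow> e + s *\<^sub>R (w - e) \<in> R"
    and a: "a \<in> F" "a \<notin> E" "a \<notin> R"
  obtains y where "y \<in> P" "circuit_step A1 b1 A2 b2 a y" "circuit_step A1 b1 A2 b2 y e"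
proof -
  have "polyhedron P"
    by (simp add: P polyhedron_polyhedron_of)
  then have "E exposed_face_of P" "R exposed_face_of P"
    using E R by (simp_all add: exposed_face_of_polyhedron)
  \<comment> \<open>Functionals exposing \<open>E\<close> and \<open>R\<close>; they replace
    coordinates in the plane of \<open>F\<close>.\<close>
  then obtain g \<beta> h \<gamma> where g: "\<And>x. x \<in> P \<Longrightarrow> g \<bullet> x \<le> \<beta>" "E = P \<inter> {x. g \<bullet> x = \<beta>}"
      and h: "\<And>x. x \<in> P \<Longrightarrow> h \<bullet> x \<le> \<gamma>" "R = P \<inter> {x. h \<bullet> x = \<gamma>}"
    unfolding exposed_face_of_def by blast
  have inP: "e \<in> P" "d \<in> P" "w \<in> P" "a \<in> P"
    using E F R e d w a by blast+
  have less: "g \<bullet> w < \<beta>" "g \<bullet> a < \<beta>" "h \<bullet> d < \<gamma>" "h \<bullet> a < \<gamma>"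
    using inP g h d w a by (auto simp: order.strict_iff_order)
  have eq: "g \<bullet> e = \<beta>" "g \<bullet> d = \<beta>" "h \<bullet> e = \<gamma>" "h \<bullet> w = \<gamma>"
    using e d w g h by auto
  have "w \<noteq> e" "d \<noteq> e"
    using w e d by auto
  have "d - e \<notin> span {w - e}"
  proof
    assume "d - e \<in> span {w - e}"
    then obtain c where "d - e = c *\<^sub>R (w - e)"
      by (auto simp: span_singleton)
    then have "h \<bullet> (d - e) = c * (h \<bullet> (w - e))"
      by simp
    then show False
      using eq less by (simp add: inner_diff_right)
  qed
  then obtain x s where xs: "a - e = x *\<^sub>R (d - e) + s *\<^sub>R (w - e)"
    using aff_dim_le_2_combination[OF F(2), of e d w a] e d w a E R \<open>w \<noteq> e\<close> by blast
  \<comment> \<open>\<open>h\<close> is constant on \<open>R\<close> and \<open>g\<close> on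
    \<open>E\<close>, so each functional isolates one coefficient of \<open>a - e\<close> and
    determines its sign.\<close>
  have "h \<bullet> (a - e) = x * (h \<bullet> (d - e))" "g \<bullet> (a - e) = s * (g \<bullet> (w - e))"
    using eq unfolding xs by (simp_all add: inner_diff_right inner_add_right)
  then have prod: "x * (h \<bullet> d - \<gamma>) < 0" "s * (g \<bullet> w - \<beta>) < 0"
    using less eq by (simp_all add: inner_diff_right)
  then have "x > 0" "s > 0"
    using less by (auto simp: mult_less_0_iff)
  define y where "y = e + s *\<^sub>R (w - e)"
  have "y \<in> R"
    using ray \<open>s > 0\<close> by (simp add: y_def)
  then have "y \<in> P"
    using R F by blast
  moreover have "circuit_step A1 b1 A2 b2 a y"
  proof (rule circuit_stepI[OF rat _ _ R(1)[unfolded P]])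
    have "y - a = (- x) *\<^sub>R (d - e)"
      using xs by (simp add: y_def algebra_simps)
    moreover have "circuit_direction A1 A2 (d - e)"
      using circuit_direction_edge[OF E(1)[unfolded P] E(3) e(1) d(1)] \<open>d \<noteq> e\<close> by simp
    ultimately show "circuit_direction A1 A2 (y - a)"
      using circuit_direction_scaleR[of A1 A2 "d - e" "- x"] \<open>x > 0\<close> by simp
  qed (use R inP a \<open>y \<in> R\<close> P in auto)
  moreover have "circuit_step A1 b1 A2 b2 y e"
  proof (rule circuit_stepI[OF rat])
    have "e - y = (- s) *\<^sub>R (w - e)"
      by (simp add: y_def)
    moreover have "circuit_direction A1 A2 (w - e)"
      using circuit_direction_edge[OF R(1)[unfolded P] R(3) e(2) w(1)] \<open>w \<noteq> e\<close> by simp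
    ultimately show "circuit_direction A1 A2 (e - y)"
      using circuit_direction_scaleR[of A1 A2 "w - e" "- s"] \<open>s > 0\<close> by simp
    \<comment> \<open>The first step is stopped by the face \<open>R\<close>, the second by the
      vertex itself.\<close>
    show "{e} face_of polyhedron_of A1 b1 A2 b2"
      using e by (simp add: face_of_singleton P)
    show "y \<notin> {e}"
      using \<open>s > 0\<close> \<open>w \<noteq> e\<close> by (simp add: y_def)
  qed (use \<open>y \<in> P\<close> P in auto)
  ultimately show thesis
    by (rule that)
qed

lemma edge_step:
  assumes rat: "rational_rows A1" "rational_rows A2"
    and G: "G face_of polyhedron_of A1 b1 A2 b2" "aff_dim G \<le> 1" "u \<in> G" "v \<in> G" "u \<noteq> v"
    and v: "v extreme_point_of polyhedron_of A1 b1 A2 b2"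
  shows "circuit_step A1 b1 A2 b2 u v"
proof (rule circuit_stepI[OF rat])
  show "circuit_direction A1 A2 (v - u)"
    using circuit_direction_edge[OF G] .
  show "{v} face_of polyhedron_of A1 b1 A2 b2"
    using v by (simp add: face_of_singleton)
qed (use G face_of_imp_subset in auto)

section \<open>Polyhedra with isomorphic face lattices\<close>

text \<open>The points \<open>u0\<close> and \<open>q0\<close> make both polyhedra pointed, so that
  dimensions can be compared along \<open>\<phi>\<close> and along its inverse.\<close>

locale polyhedron_realization =
  fixes A1 A2 :: "(real ^ 'n) list" and b1 b2 :: "real list"
    and C1 C2 :: "(real ^ 'm) list" and d1 d2 :: "real list"
    and \<phi> :: "(real ^ 'n) set \<Rightarrow> (real ^ 'm) set" and P Q u0 q0
  defines P_def: "P \<equiv> polyhedron_of A1 b1 A2 b2" and Q_def: "Q \<equiv> polyhedron_of C1 d1 C2 d2"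
  assumes rational: "rational_rows A1" "rational_rows A2"
    and bij: "bij_betw \<phi> {F. F face_of P} {G. G face_of Q}"
    and order: "\<And>F F'. F face_of P \<Longrightarrow> F' face_of P \<Longrightarrow> F \<subseteq> F' \<longleftrightarrow> \<phi> F \<subseteq> \<phi> F'"
    and u0: "u0 extreme_point_of P" and q0: "q0 extreme_point_of Q"
begin

definition \<psi> :: "(real ^ 'm) set \<Rightarrow> (real ^ 'n) set" where
  "\<psi> = inv_into {F. F face_of P} \<phi>"

lemma \<phi>_face: "F face_of P \<Longrightarrow> \<phi> F face_of Q"
  using bij_betwE[OF bij] by simp

lemma \<psi>_face: "G face_of Q \<Longrightarrow> \<psi> G face_of P"
  using bij_betwE[OF bij_betw_inv_into[OF bij]] by (simp add: \<psi>_def)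

lemma \<phi>_\<psi>: "G face_of Q \<Longrightarrow> \<phi> (\<psi> G) = G"
  using bij by (simp add: bij_betw_inv_into_right \<psi>_def)

lemma \<psi>_\<phi>: "F face_of P \<Longrightarrow> \<psi> (\<phi> F) = F"
  using bij by (simp add: bij_betw_inv_into_left \<psi>_def)

lemma \<psi>_subset_iff: "G face_of Q \<Longrightarrow> G' face_of Q \<Longrightarrow> \<psi> G \<subseteq> \<psi> G' \<longleftrightarrow> G \<subseteq> G'"
  by (simp add: order \<psi>_face \<phi>_\<psi>)

text \<open>Both \<open>\<phi>\<close> and \<open>\<psi>\<close> preserve strict inclusion of faces,
  so neither lowers the dimension.\<close>

lemma aff_dim_\<phi>:
  assumes F: "F face_of P"
  shows "aff_dim (\<phi> F) = aff_dim F"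
proof (rule antisym)
  show "aff_dim F \<le> aff_dim (\<phi> F)"
  proof (rule aff_dim_le_of_face_embedding[OF u0[unfolded P_def] _ _ _ F[unfolded P_def]])
    show "convex Q"
      by (simp add: Q_def polyhedron_polyhedron_of polyhedron_imp_convex)
    show "\<phi> F \<subset> \<phi> F'" if "F face_of polyhedron_of A1 b1 A2 b2" "F' face_of polyhedron_of A1 b1 A2 b2"
      "F \<subset> F'" for F F'
      using that by (simp add: less_le_not_le order flip: P_def)
  qed (simp add: \<phi>_face flip: P_def)
  have "aff_dim (\<phi> F) \<le> aff_dim (\<psi> (\<phi> F))"
  proof (rule aff_dim_le_of_face_embedding[OF q0[unfolded Q_def] _ _ _ \<phi>_face[OF F, unfolded Q_def]])
    show "convex P"
      by (simp add: P_def polyhedron_polyhedron_of polyhedron_imp_convex)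
    show "\<psi> F \<subset> \<psi> F'" if "F face_of polyhedron_of C1 d1 C2 d2" "F' face_of polyhedron_of C1 d1 C2 d2"
      "F \<subset> F'" for F F'
      using that by (simp add: less_le_not_le \<psi>_subset_iff flip: Q_def)
  qed (simp add: \<psi>_face flip: Q_def)
  then show "aff_dim (\<phi> F) \<le> aff_dim F"
    by (simp add: \<psi>_\<phi> F)
qed

lemma aff_dim_\<psi>: "G face_of Q \<Longrightarrow> aff_dim (\<psi> G) = aff_dim G"
  using aff_dim_\<phi>[OF \<psi>_face] by (simp add: \<phi>_\<psi>)

text \<open>For a vertex \<open>q\<close>, the face \<open>\<psi> {q}\<close> has dimension 0, so it
  is a singleton and \<open>the_elem\<close> returns its point.\<close>

definition vert :: "real ^ 'm \<Rightarrow> real ^ 'n" where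
  "vert q = the_elem (\<psi> {q})"

lemma \<psi>_vertex:
  assumes "q extreme_point_of Q"
  shows "\<psi> {q} = {vert q}"
proof -
  have "aff_dim (\<psi> {q}) = 0"
    using assms by (simp add: aff_dim_\<psi> face_of_singleton)
  then obtain p where "\<psi> {q} = {p}"
    unfolding aff_dim_eq_0 ..
  then show ?thesis
    by (simp add: vert_def)
qed

lemma vert_extreme: "q extreme_point_of Q \<Longrightarrow> vert q extreme_point_of P"
  using \<psi>_face[of "{q}"] by (simp add: \<psi>_vertex face_of_singleton)

lemma vert_mem_iff: "q extreme_point_of Q \<Longrightarrow> G face_of Q \<Longrightarrow> vert q \<in> \<psi> G \<longleftrightarrow> q \<in> G"
  using \<psi>_subset_iff[of "{q}" G] by (simp add: \<psi>_vertex face_of_singleton)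

lemma vert_inject: "q extreme_point_of Q \<Longrightarrow> q' extreme_point_of Q \<Longrightarrow> vert q = vert q' \<longleftrightarrow> q = q'"
  using vert_mem_iff[of q "{q'}"] by (simp add: \<psi>_vertex face_of_singleton)

lemma extreme_point_vert:
  assumes "u extreme_point_of P"
  obtains q where "q extreme_point_of Q" "u = vert q"
proof -
  have u: "{u} face_of P"
    using assms by (simp add: face_of_singleton)
  then have "aff_dim (\<phi> {u}) = 0"
    by (simp add: aff_dim_\<phi>)
  then obtain q where q: "\<phi> {u} = {q}"
    by (auto simp: aff_dim_eq_0)
  then have extreme: "q extreme_point_of Q"
    using \<phi>_face[OF u] by (simp add: face_of_singleton)
  then have "{vert q} = {u}"
    using \<psi>_\<phi>[OF u] q by (simp add: \<psi>_vertex)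
  then show thesis
    using that extreme by simp
qed

abbreviation steps :: "((real ^ 'n) \<times> (real ^ 'n)) set" where
  "steps \<equiv> {(y, y'). y \<in> P \<and> circuit_step A1 b1 A2 b2 y y'}"

lemma edge_steps:
  assumes G: "G face_of Q" "aff_dim G \<le> 1" "q \<in> G" "q' \<in> G" "q \<noteq> q'"
    and q: "q extreme_point_of Q" "q' extreme_point_of Q"
  shows "(vert q, vert q') \<in> steps"
proof -
  have "circuit_step A1 b1 A2 b2 (vert q) (vert q')"
    using edge_step[OF rational, of "\<psi> G"] G q
    by (simp add: \<psi>_face aff_dim_\<psi> vert_mem_iff vert_inject vert_extreme flip: P_def)
  then show ?thesis
    using vert_extreme[OF q(1)] by (simp add: extreme_point_of_def)
qed

text \<open>Unboundedness of \<open>R\<close> enters as a condition visible in the lattice: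
  \<open>e\<close> is its only vertex. This carries over to \<open>\<psi> R\<close>, where a second
  point \<open>w\<close> then spans a ray.\<close>

lemma two_steps:
  assumes faces: "F face_of Q" "E face_of Q" "R face_of Q"
    and dim: "aff_dim F \<le> 2" "aff_dim E \<le> 1" "aff_dim R \<le> 1" and sub: "E \<subseteq> F" "R \<subseteq> F" "\<not> R \<subseteq> E"
    and e: "e extreme_point_of Q" "e \<in> E" "e \<in> R"
    and d: "d extreme_point_of Q" "d \<in> E" "d \<notin> R"
    and a: "a extreme_point_of Q" "a \<in> F" "a \<notin> E" "a \<notin> R"
    and unique: "\<And>q. q extreme_point_of Q \<Longrightarrow> q \<in> R \<Longrightarrow> q = e"
  shows "(vert a, vert e) \<in> steps ^^ 2"
proof -
  have "\<not> \<psi> R \<subseteq> \<psi> E"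
    using sub(3) \<psi>_subset_iff[OF faces(3,2)] by simp
  then obtain w where w: "w \<in> \<psi> R" "w \<notin> \<psi> E"
    by blast
  have "polyhedron P"
    by (simp add: P_def polyhedron_polyhedron_of)
  have ray: "vert e + s *\<^sub>R (w - vert e) \<in> \<psi> R" if "s \<ge> 0" for s
  proof (rule edge_with_one_vertex_unbounded)
    show "convex P" "closed P"
      using \<open>polyhedron P\<close> by (simp_all add: polyhedron_imp_convex polyhedron_imp_closed)
    show "\<psi> R face_of P" "aff_dim (\<psi> R) \<le> 1" "vert e \<in> \<psi> R"
      using faces dim e by (simp_all add: \<psi>_face aff_dim_\<psi> vert_mem_iff)
    show "w \<noteq> vert e"
      using w e faces by (auto simp: vert_mem_iff)
    show "x = vert e" if "x \<in> \<psi> R" "x extreme_point_of P" for x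
      using that faces unique by (metis extreme_point_vert vert_mem_iff)
  qed (use w that in auto)
  have "\<psi> F \<subseteq> P"
    using faces \<psi>_face face_of_imp_subset by blast
  then obtain y where "y \<in> P" "circuit_step A1 b1 A2 b2 (vert a) y" "circuit_step A1 b1 A2 b2 y (vert e)"
    using two_steps_via_unbounded_edge[OF rational P_def[THEN meta_eq_to_obj_eq], of "\<psi> F" "\<psi> E" "\<psi> R" "vert e" "vert d" w "vert a"]
      faces dim sub e d a w ray
    by (auto simp: \<psi>_face aff_dim_\<psi> \<psi>_subset_iff vert_mem_iff vert_extreme)
  moreover have "vert a \<in> P"
    using vert_extreme[OF a(1)] by (simp add: extreme_point_of_def)
  ultimately show ?thesis
    by (auto simp: numeral_2_eq_2 intro!: relcompI)
qed

end

section \<open>The Klee-Walkup polyhedron\<close>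

text \<open>Indexing faces by rows reverses inclusion; the empty row set gives the whole
  polyhedron.\<close>

definition tight_face :: "nat set \<Rightarrow> (real ^ 4) set" where
  "tight_face S = {x \<in> klee_walkup. \<forall>i\<in>S. klee_walkup_A ! i \<bullet> x = klee_walkup_b ! i}"

section \<open>Rows and vertices in coordinates\<close>

lemma vector_4:
  "(vector [a, b, c, d] :: 'a::zero ^ 4) $ 1 = a" "(vector [a, b, c, d] :: 'a ^ 4) $ 2 = b"
  "(vector [a, b, c, d] :: 'a ^ 4) $ 3 = c" "(vector [a, b, c, d] :: 'a ^ 4) $ 4 = d"
  unfolding vector_def by simp_all

lemma klee_walkup_inner:
  "klee_walkup_A ! 0 \<bullet> x = - 6 * x $ 1 - 3 * x $ 2 + x $ 4"
  "klee_walkup_A ! Suc 0 \<bullet> x = - 3 * x $ 1 - 6 * x $ 2 + x $ 3"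
  "klee_walkup_A ! 2 \<bullet> x = - 35 * x $ 1 - 45 * x $ 2 + 6 * x $ 3 + 3 * x $ 4"
  "klee_walkup_A ! 3 \<bullet> x = - 45 * x $ 1 - 35 * x $ 2 + 3 * x $ 3 + 6 * x $ 4"
  "klee_walkup_A ! 4 \<bullet> x = x $ 1"
  "klee_walkup_A ! 5 \<bullet> x = x $ 2"
  "klee_walkup_A ! 6 \<bullet> x = x $ 3"
  "klee_walkup_A ! 7 \<bullet> x = x $ 4"
  by (simp_all add: klee_walkup_A_def inner_vec_def sum_4 vector_4)

lemma klee_walkup_rhs:
  "klee_walkup_b ! 0 = -1" "klee_walkup_b ! Suc 0 = -1" "klee_walkup_b ! 2 = -8" "klee_walkup_b ! 3 = -8"
  "klee_walkup_b ! 4 = 0" "klee_walkup_b ! 5 = 0" "klee_walkup_b ! 6 = 0" "klee_walkup_b ! 7 = 0"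
  by (simp_all add: klee_walkup_b_def)

lemma all_less_8: "(\<forall>i < 8. P i) \<longleftrightarrow> P 0 \<and> P (Suc 0) \<and> P 2 \<and> P 3 \<and> P 4 \<and> P 5 \<and> P 6 \<and> P (7::nat)"
  by (simp add: eval_nat_numeral All_less_Suc conj_ac)

lemma length_klee_walkup_A: "length klee_walkup_A = 8"
  by (simp add: klee_walkup_A_def)

lemma mem_klee_walkup:
  "x \<in> klee_walkup \<longleftrightarrow> (\<forall>i < 8. klee_walkup_A ! i \<bullet> x \<ge> klee_walkup_b ! i)"
  by (simp add: klee_walkup_def polyhedron_of_def length_klee_walkup_A)

text \<open>Each vertex comes with the rows that are tight at it; the paper numbers the rows from 1.\<close>

definition klee_walkup_vertices :: "(nat list \<times> (real ^ 4)) list" where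
  "klee_walkup_vertices =
     [([0, 1, 2, 3], vector [1, 1, 8, 8]),
      ([0, 2, 3, 4], vector [0, 1/2, 13/6, 1/2]),
      ([0, 3, 4, 7], vector [0, 1/3, 11/9, 0]),
      ([0, 3, 5, 6], vector [2/9, 0, 0, 1/3]),
      ([0, 3, 6, 7], vector [11/75, 1/25, 0, 0]),
      ([0, 5, 6, 7], vector [1/6, 0, 0, 0]),
      ([1, 2, 3, 5], vector [1/2, 0, 1/2, 13/6]),
      ([1, 2, 4, 7], vector [0, 2/9, 1/3, 0]),
      ([1, 2, 5, 6], vector [1/3, 0, 0, 11/9]),
      ([1, 2, 6, 7], vector [1/25, 11/75, 0, 0]),
      ([1, 4, 6, 7], vector [0, 1/6, 0, 0]),
      ([2, 3, 4, 7], vector [0, 8/25, 16/15, 0]),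
      ([2, 3, 5, 6], vector [8/25, 0, 0, 16/15]),
      ([2, 3, 6, 7], vector [1/10, 1/10, 0, 0]),
      ([4, 5, 6, 7], vector [0, 0, 0, 0])]"

lemma klee_walkup_vertices_feasible:
  "\<forall>(S, p) \<in> set klee_walkup_vertices.
     p \<in> klee_walkup \<and> (\<forall>i < 8. klee_walkup_A ! i \<bullet> p = klee_walkup_b ! i \<longleftrightarrow> i \<in> set S)"
  unfolding mem_klee_walkup all_less_8 klee_walkup_inner klee_walkup_rhs klee_walkup_vertices_def
  by (simp add: vector_4)

lemma vec4_eq_iff: "(x :: real ^ 4) = y \<longleftrightarrow> x $ 1 = y $ 1 \<and> x $ 2 = y $ 2 \<and> x $ 3 = y $ 3 \<and> x $ 4 = y $ 4"
  by (simp add: vec_eq_iff forall_4)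

lemma klee_walkup_vertices_unique:
  "\<forall>(S, p) \<in> set klee_walkup_vertices.
     \<forall>x. (\<forall>i\<in>set S. klee_walkup_A ! i \<bullet> x = klee_walkup_b ! i) \<longrightarrow> x = p"
  unfolding klee_walkup_vertices_def
  by (simp add: klee_walkup_inner klee_walkup_rhs vec4_eq_iff vector_4)

definition vertex_rows :: "nat list list" where
  "vertex_rows = map fst klee_walkup_vertices"

text \<open>The graph search can then be evaluated without touching the real vectors stored beside
  the row lists.\<close>

lemma vertex_rows_code [code]:
  "vertex_rows =
     [[0, 1, 2, 3], [0, 2, 3, 4], [0, 3, 4, 7], [0, 3, 5, 6], [0, 3, 6, 7], [0, 5, 6, 7],
      [1, 2, 3, 5], [1, 2, 4, 7], [1, 2, 5, 6], [1, 2, 6, 7], [1, 4, 6, 7],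
      [2, 3, 4, 7], [2, 3, 5, 6], [2, 3, 6, 7], [4, 5, 6, 7]]"
  by (simp add: vertex_rows_def klee_walkup_vertices_def)

text \<open>Completeness of the vertex list: any other choice of four rows has no feasible point at
  which all four are tight.\<close>

lemma klee_walkup_four_tight:
  assumes x: "x \<in> klee_walkup" and less: "i < j" "j < k" "k < l" "l < 8"
    and tight: "klee_walkup_A ! i \<bullet> x = klee_walkup_b ! i" "klee_walkup_A ! j \<bullet> x = klee_walkup_b ! j"
      "klee_walkup_A ! k \<bullet> x = klee_walkup_b ! k" "klee_walkup_A ! l \<bullet> x = klee_walkup_b ! l"
  shows "[i, j, k, l] \<in> set vertex_rows"
proof (rule ccontr)
  assume notin: "[i, j, k, l] \<notin> set vertex_rows"
  define a b c d where "a = x $ 1" and "b = x $ 2" and "c = x $ 3" and "d = x $ 4"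
  note abcd = a_def[symmetric] b_def[symmetric] c_def[symmetric] d_def[symmetric]
  \<comment> \<open>Indices in successor form, as the enumeration by \<open>upt_rec\<close> produces
    them.\<close>
  note rows = klee_walkup_inner[unfolded numeral_nat] klee_walkup_rhs[unfolded numeral_nat]
  have ineqs: "- 6 * a - 3 * b + d \<ge> -1" "- 3 * a - 6 * b + c \<ge> -1"
      "- 35 * a - 45 * b + 6 * c + 3 * d \<ge> -8" "- 45 * a - 35 * b + 3 * c + 6 * d \<ge> -8"
      "a \<ge> 0" "b \<ge> 0" "c \<ge> 0" "d \<ge> 0"
    using x unfolding mem_klee_walkup all_less_8 klee_walkup_inner klee_walkup_rhs abcd by simp_all
  \<comment> \<open>All 70 increasing quadruples. The 15 listed ones contradict
    \<open>notin\<close>; for each of the others the four equations contradict the eight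
    inequalities by linear arithmetic.\<close>
  have "(i, j, k, l) \<in> set [(i, j, k, l). i \<leftarrow> [0..<8], j \<leftarrow> [Suc i..<8], k \<leftarrow> [Suc j..<8], l \<leftarrow> [Suc k..<8]]"
    using less by (auto simp: image_iff)
  then show False
    apply (simp add: upt_rec)
    apply (elim disjE conjE; ((insert notin, (simp add: vertex_rows_code; fail))
      | (insert tight ineqs, (simp only: rows abcd; linarith))))
    done
qed

definition klee_walkup_vertex :: "nat list \<Rightarrow> real ^ 4" where
  "klee_walkup_vertex S = the (map_of klee_walkup_vertices S)"

lemma vertex_rows_length: "\<forall>S \<in> set vertex_rows. distinct S \<and> length S = 4 \<and> set S \<subseteq> {..<8}"
  by (simp add: vertex_rows_def klee_walkup_vertices_def)

lemma klee_walkup_vertex_mem: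
  assumes "S \<in> set vertex_rows"
  shows "(S, klee_walkup_vertex S) \<in> set klee_walkup_vertices"
proof -
  have "distinct vertex_rows"
    by (simp add: vertex_rows_def klee_walkup_vertices_def)
  then show ?thesis
    using assms by (auto simp: vertex_rows_def klee_walkup_vertex_def)
qed

lemma tight_face_klee_walkup_vertex:
  assumes "S \<in> set vertex_rows"
  shows "tight_face (set S) = {klee_walkup_vertex S}"
proof -
  have "klee_walkup_vertex S \<in> klee_walkup"
      "\<And>i. i \<in> set S \<Longrightarrow> klee_walkup_A ! i \<bullet> klee_walkup_vertex S = klee_walkup_b ! i"
    using klee_walkup_vertices_feasible klee_walkup_vertex_mem[OF assms] vertex_rows_length assms by fastforce+
  moreover have "x = klee_walkup_vertex S" if "\<forall>i\<in>set S. klee_walkup_A ! i \<bullet> x = klee_walkup_b ! i" for x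
    using klee_walkup_vertices_unique klee_walkup_vertex_mem[OF assms] that by blast
  ultimately show ?thesis
    by (auto simp: tight_face_def)
qed

lemma klee_walkup_vertex_in_tight_face_iff:
  assumes "S \<in> set vertex_rows" "X \<subseteq> {..<8}"
  shows "klee_walkup_vertex S \<in> tight_face X \<longleftrightarrow> X \<subseteq> set S"
proof -
  have "klee_walkup_vertex S \<in> klee_walkup"
      "\<And>i. i < 8 \<Longrightarrow> klee_walkup_A ! i \<bullet> klee_walkup_vertex S = klee_walkup_b ! i \<longleftrightarrow> i \<in> set S"
    using klee_walkup_vertices_feasible klee_walkup_vertex_mem[OF assms(1)] by blast+
  then show ?thesis
    using assms(2) by (auto simp: tight_face_def)
qed

section \<open>Faces cut out by tight rows, their dimensions and extreme points\<close>

lemma tight_face_mono: "X \<subseteq> Y \<Longrightarrow> tight_face Y \<subseteq> tight_face X"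
  by (auto simp: tight_face_def)

lemma convex_klee_walkup: "convex klee_walkup"
  by (simp add: klee_walkup_def polyhedron_polyhedron_of polyhedron_imp_convex)

lemma tight_face_face_of:
  assumes "X \<subseteq> {..<8}"
  shows "tight_face X face_of klee_walkup"
proof -
  have "finite X"
    using assms finite_subset by blast
  then show ?thesis
    using assms
  proof (induction X)
    case empty
    then show ?case
      by (simp add: tight_face_def convex_klee_walkup face_of_refl)
  next
    case (insert i X)
    have "klee_walkup \<inter> {x. klee_walkup_A ! i \<bullet> x = klee_walkup_b ! i} face_of klee_walkup"
      using insert.prems
      by (intro face_of_Int_supporting_hyperplane_ge convex_klee_walkup) (simp add: mem_klee_walkup)
    then have "(klee_walkup \<inter> {x. klee_walkup_A ! i \<bullet> x = klee_walkup_b ! i}) \<inter> tight_face X face_of klee_walkup"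
      using insert.IH insert.prems by (simp add: face_of_Int)
    also have "(klee_walkup \<inter> {x. klee_walkup_A ! i \<bullet> x = klee_walkup_b ! i}) \<inter> tight_face X = tight_face (insert i X)"
      by (auto simp: tight_face_def)
    finally show ?case .
  qed
qed

lemma klee_walkup_vertex_extreme:
  "S \<in> set vertex_rows \<Longrightarrow> klee_walkup_vertex S extreme_point_of klee_walkup"
  using tight_face_face_of[of "set S"] vertex_rows_length
  by (simp add: tight_face_klee_walkup_vertex face_of_singleton)

text \<open>Each further hyperplane lowers the dimension by at most one; the common point
  \<open>p\<close> keeps the intersections nonempty.\<close>

lemma aff_dim_hyperplanes_le:
  fixes a :: "'i \<Rightarrow> 'a::euclidean_space"
  assumes "finite Z" and "\<forall>i \<in> X \<union> Z. a i \<bullet> p = b i"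
  shows "aff_dim {x. \<forall>i\<in>X. a i \<bullet> x = b i} \<le> aff_dim {x. \<forall>i \<in> X \<union> Z. a i \<bullet> x = b i} + int (card Z)"
  using assms
proof (induction Z)
  case (insert j Z)
  have aff: "affine {x. \<forall>i \<in> X \<union> Z. a i \<bullet> x = b i}"
    by (auto simp: affine_def inner_add_right simp flip: distrib_right)
  have eq: "{x. \<forall>i \<in> X \<union> insert j Z. a i \<bullet> x = b i} = {x. \<forall>i \<in> X \<union> Z. a i \<bullet> x = b i} \<inter> {x. a j \<bullet> x = b j}"
    by auto
  have "p \<in> {x. \<forall>i \<in> X \<union> Z. a i \<bullet> x = b i} \<inter> {x. a j \<bullet> x = b j}"
    using insert.prems by auto
  then have "{x. \<forall>i \<in> X \<union> Z. a i \<bullet> x = b i} \<inter> {x. a j \<bullet> x = b j} \<noteq> {}"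
    by blast
  then have "aff_dim {x. \<forall>i \<in> X \<union> Z. a i \<bullet> x = b i} \<le> aff_dim {x. \<forall>i \<in> X \<union> insert j Z. a i \<bullet> x = b i} + 1"
    unfolding eq aff_dim_affine_Int_hyperplane[OF aff] by simp
  then show ?case
    using insert by simp
qed simp

text \<open>The rows in \<open>set S - X\<close> cut the solution space of the rows in
  \<open>X\<close> down to a single point. This bounds the dimension without any rank
  computation.\<close>

lemma aff_dim_tight_face:
  assumes S: "S \<in> set vertex_rows" and X: "X \<subseteq> set S"
  shows "aff_dim (tight_face X) \<le> int (card (set S - X))"
proof -
  let ?H = "\<lambda>Y. {x. \<forall>i\<in>Y. klee_walkup_A ! i \<bullet> x = klee_walkup_b ! i}"
  have "klee_walkup_vertex S \<in> tight_face (set S)"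
    by (simp add: tight_face_klee_walkup_vertex S)
  then have p: "\<forall>i\<in>set S. klee_walkup_A ! i \<bullet> klee_walkup_vertex S = klee_walkup_b ! i"
    by (simp add: tight_face_def)
  have "x = klee_walkup_vertex S" if "x \<in> ?H (set S)" for x
    using klee_walkup_vertices_unique klee_walkup_vertex_mem[OF S] that by blast
  then have H: "?H (set S) = {klee_walkup_vertex S}"
    using p by blast
  have "aff_dim (tight_face X) \<le> aff_dim (?H X)"
    by (rule aff_dim_subset) (auto simp: tight_face_def)
  also have "\<dots> \<le> aff_dim (?H (X \<union> (set S - X))) + int (card (set S - X))"
    using p X by (intro aff_dim_hyperplanes_le[where p="klee_walkup_vertex S"]) auto
  also have "X \<union> (set S - X) = set S"
    using X by blast
  finally show ?thesis
    unfolding H by simp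
qed

text \<open>With at most three tight rows, some nonzero direction is orthogonal to all of them and
  can be followed both ways, so at least four rows are tight.\<close>

lemma klee_walkup_extreme_point:
  assumes x: "x extreme_point_of klee_walkup"
  obtains S where "S \<in> set vertex_rows" "x = klee_walkup_vertex S"
proof -
  define T where "T = {i. i < 8 \<and> klee_walkup_A ! i \<bullet> x = klee_walkup_b ! i}"
  have "finite T"
    by (simp add: T_def)
  have mem: "x \<in> polyhedron_of [] [] klee_walkup_A klee_walkup_b"
    using x by (simp add: extreme_point_of_def klee_walkup_def)
  have "4 \<le> card T"
  proof (rule ccontr)
    assume "\<not> 4 \<le> card T"
    moreover have "dim ((!) klee_walkup_A ` T) \<le> card ((!) klee_walkup_A ` T)"
      using \<open>finite T\<close> by (intro dim_le_card span_superset) simp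
    moreover have "card ((!) klee_walkup_A ` T) \<le> card T"
      using \<open>finite T\<close> by (rule card_image_le)
    ultimately have "dim ((!) klee_walkup_A ` T) < DIM(real ^ 4)"
      by simp
    then obtain d where "d \<noteq> 0" and d: "\<And>y. y \<in> span ((!) klee_walkup_A ` T) \<Longrightarrow> orthogonal d y"
      using orthogonal_to_subspace_exists by blast
    have "klee_walkup_A ! i \<bullet> d = 0" if "i < length klee_walkup_A" "klee_walkup_A ! i \<bullet> x = klee_walkup_b ! i" for i
      using d[of "klee_walkup_A ! i"] that
      by (simp add: T_def length_klee_walkup_A span_base orthogonal_def inner_commute)
    moreover have "d \<in> rows_kernel []"
      by (simp add: rows_kernel_def)
    ultimately obtain \<epsilon> where "\<epsilon> > 0" and \<epsilon>: "\<And>\<delta>. \<bar>\<delta>\<bar> = \<epsilon> \<Longrightarrow> x + \<delta> *\<^sub>R d \<in> klee_walkup"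
      unfolding klee_walkup_def using polyhedron_of_perturbation[OF mem] by metis
    have "x + \<epsilon> *\<^sub>R d \<in> klee_walkup" "x + (- \<epsilon>) *\<^sub>R d \<in> klee_walkup"
      using \<open>\<epsilon> > 0\<close> by (intro \<epsilon>; simp)+
    moreover have "x \<in> open_segment (x + \<epsilon> *\<^sub>R d) (x + (- \<epsilon>) *\<^sub>R d)"
      using \<open>\<epsilon> > 0\<close> \<open>d \<noteq> 0\<close>
      by (auto simp: in_segment algebra_simps simp flip: scaleR_left.add intro!: exI[of _ "1/2"])
    ultimately show False
      using x unfolding extreme_point_of_def by blast
  qed
  \<comment> \<open>More than four rows might be tight a priori; the four smallest already determine
    a listed vertex.\<close>
  define L where "L = sorted_list_of_set T"
  have sorted: "sorted_wrt (<) L" and len: "length L \<ge> 4" and set: "set L = T"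
    using \<open>finite T\<close> \<open>4 \<le> card T\<close> by (simp_all add: L_def)
  have less: "L ! 0 < L ! 1" "L ! 1 < L ! 2" "L ! 2 < L ! 3"
    using len by (auto intro!: sorted_wrt_nth_less[OF sorted])
  have tight: "L ! n \<in> T" if "n < 4" for n
    using len that by (simp flip: set)
  define S where "S = [L ! 0, L ! 1, L ! 2, L ! 3]"
  have "x \<in> klee_walkup"
    using x by (simp add: extreme_point_of_def)
  moreover have "L ! 3 < 8"
    using tight[of 3] by (simp add: T_def)
  ultimately have S: "S \<in> set vertex_rows"
    unfolding S_def using less tight[of 0] tight[of 1] tight[of 2] tight[of 3]
    by (intro klee_walkup_four_tight) (simp_all add: T_def)
  moreover have "x \<in> tight_face (set S)"
    using \<open>x \<in> klee_walkup\<close> tight[of 0] tight[of 1] tight[of 2] tight[of 3]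
    by (simp add: tight_face_def S_def T_def)
  ultimately show thesis
    using that by (simp add: tight_face_klee_walkup_vertex)
qed

section \<open>Breadth-first search on row lists, adjacency meaning three common rows out of
  four\<close>

definition adjacent :: "nat list \<Rightarrow> nat list \<Rightarrow> bool" where
  "adjacent S T \<longleftrightarrow> length (filter (\<lambda>i. i \<notin> set T) S) = 1"

definition expand :: "nat list list \<Rightarrow> nat list list" where
  "expand L = L @ filter (\<lambda>T. list_ex (\<lambda>U. adjacent U T) L) (filter (\<lambda>T. T \<notin> set L) vertex_rows)"

primrec reachable :: "nat \<Rightarrow> nat list \<Rightarrow> nat list list" where
  "reachable 0 S = [S]"
| "reachable (Suc k) S = expand (reachable k S)"

text \<open>The search knows only row lists; \<open>f\<close> and \<open>r\<close> are left open so
  that its result applies to the vertices of an arbitrary realization and to its circuit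
  steps.\<close>

lemma reachable_relpow:
  assumes S: "S \<in> set vertex_rows"
    and r: "\<And>U T. U \<in> set vertex_rows \<Longrightarrow> T \<in> set vertex_rows \<Longrightarrow> adjacent U T \<Longrightarrow> (f U, f T) \<in> r"
    and T: "T \<in> set (reachable k S)"
  shows "T \<in> set vertex_rows \<and> (\<exists>j\<le>k. (f S, f T) \<in> r ^^ j)"
  using T
proof (induction k arbitrary: T)
  case 0
  then show ?case
    using S by auto
next
  case (Suc k)
  show ?case
  proof (cases "T \<in> set (reachable k S)")
    case True
    then show ?thesis
      using Suc.IH le_Suc_eq by blast
  next
    case False
    then obtain U where T: "T \<in> set vertex_rows" and U: "U \<in> set (reachable k S)" "adjacent U T"
      using Suc.prems by (auto simp: expand_def list_ex_iff)
    then obtain j where "j \<le> k" "(f S, f U) \<in> r ^^ j" "(f U, f T) \<in> r"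
      using Suc.IH r by blast
    then have "Suc j \<le> Suc k" "(f S, f T) \<in> r ^^ Suc j"
      by auto
    then show ?thesis
      using T by blast
  qed
qed

text \<open>The second halves of the two detours, through \<open>[0, 5, 6, 7]\<close> and
  \<open>[0, 2, 3, 4]\<close> respectively.\<close>

lemma reachable_exceptions:
  "[4, 5, 6, 7] \<in> set (reachable 2 [0, 3, 5, 6])" "[0, 1, 2, 3] \<in> set (reachable 2 [0, 3, 4, 7])"
  by code_simp+

text \<open>A constant of its own, so that \<open>code_simp\<close> does not unfold it below a binder.\<close>

definition reaches_others :: "nat list \<Rightarrow> bool" where
  "reaches_others S \<longleftrightarrow> (\<forall>T \<in> set vertex_rows. T \<in> set (reachable 4 S) \<or>
     S = [0, 1, 2, 3] \<and> T = [4, 5, 6, 7] \<or> S = [4, 5, 6, 7] \<and> T = [0, 1, 2, 3])"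

lemma all_reach_others: "list_all reaches_others vertex_rows"
  by code_simp

lemma adjacent_card:
  assumes "adjacent S T" "distinct S"
  shows "card (set S - set T) = 1"
proof -
  have "set S - set T = set (filter (\<lambda>i. i \<notin> set T) S)"
    by auto
  then show ?thesis
    using assms distinct_card[of "filter (\<lambda>i. i \<notin> set T) S"] by (simp add: adjacent_def)
qed

text \<open>The search settles all ordered pairs except one pair in its two orders. Circuit walks
  cannot simply be reversed, so each order gets its own detour of two special steps and at most two
  edges.\<close>

lemma circuit_distance_le_4:
  fixes A1 A2 :: "(real ^ 'n) list" and b1 b2 :: "real list"
  defines "P \<equiv> polyhedron_of A1 b1 A2 b2"
  assumes rational: "rational_rows A1" "rational_rows A2"
    and bij: "bij_betw \<phi> {F. F face_of P} {G. G face_of klee_walkup}"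
    and order: "\<And>F F'. F face_of P \<Longrightarrow> F' face_of P \<Longrightarrow> F \<subseteq> F' \<longleftrightarrow> \<phi> F \<subseteq> \<phi> F'"
    and uv: "u extreme_point_of P" "v extreme_point_of P"
  shows "circuit_distance A1 b1 A2 b2 u v \<le> 4"
proof -
  have "[4, 5, 6, 7] \<in> set vertex_rows"
    by (simp add: vertex_rows_code)
  then interpret polyhedron_realization A1 A2 b1 b2 "[]" klee_walkup_A "[]" klee_walkup_b \<phi> P klee_walkup
      u "klee_walkup_vertex [4, 5, 6, 7]"
    using rational bij order uv(1)
    by unfold_locales (simp_all add: P_def klee_walkup_def[THEN eq_reflection] klee_walkup_vertex_extreme[unfolded klee_walkup_def])
  let ?f = "\<lambda>S. vert (klee_walkup_vertex S)"
  have rows_less: "set S \<subseteq> {..<8}" if "S \<in> set vertex_rows" for S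
    using that vertex_rows_length by blast
  have edge: "(?f S, ?f T) \<in> steps"
    if S: "S \<in> set vertex_rows" and T: "T \<in> set vertex_rows" and "adjacent S T" for S T
  proof (rule edge_steps)
    have card: "card (set S - set T) = 1"
      using adjacent_card \<open>adjacent S T\<close> S vertex_rows_length by blast
    have X: "set S \<inter> set T \<subseteq> {..<8}"
      using rows_less[OF S] by blast
    show "tight_face (set S \<inter> set T) face_of klee_walkup"
      by (rule tight_face_face_of[OF X])
    have "set S - set S \<inter> set T = set S - set T"
      by blast
    then show "aff_dim (tight_face (set S \<inter> set T)) \<le> 1"
      using aff_dim_tight_face[OF S, of "set S \<inter> set T"] card by simp
    show "klee_walkup_vertex S \<in> tight_face (set S \<inter> set T)" "klee_walkup_vertex T \<in> tight_face (set S \<inter> set T)"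
      by (simp_all add: klee_walkup_vertex_in_tight_face_iff[OF _ X] S T)
    have "klee_walkup_vertex T \<in> tight_face (set T)"
      by (simp add: tight_face_klee_walkup_vertex[OF T])
    moreover have "klee_walkup_vertex S \<notin> tight_face (set T)"
    proof
      assume "klee_walkup_vertex S \<in> tight_face (set T)"
      then have "set T \<subseteq> set S"
        using klee_walkup_vertex_in_tight_face_iff[OF S rows_less[OF T]] by simp
      moreover have "card (set T) = 4" "card (set S) = 4"
        using S T vertex_rows_length distinct_card by metis+
      ultimately have "set T = set S"
        by (intro card_subset_eq) simp_all
      then show False
        using card by simp
    qed
    ultimately show "klee_walkup_vertex S \<noteq> klee_walkup_vertex T"
      by auto
  qed (simp_all add: klee_walkup_vertex_extreme S T)
  \<comment> \<open>Here \<open>F\<close>, \<open>E\<close> and \<open>R\<close> are row sets: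
    \<open>E\<close> and \<open>R\<close> each extend \<open>F\<close> by one row tight at the
    corner \<open>e\<close>. The vertex \<open>d\<close> is the other end of the bounded edge, and
    \<open>w\<close> certifies that the unbounded edge is not contained in it.\<close>
  have two: "(?f a, ?f e) \<in> steps ^^ 2"
    if mem: "a \<in> set vertex_rows" "e \<in> set vertex_rows" "d \<in> set vertex_rows"
      and sub: "F \<subseteq> E" "F \<subseteq> R" "E \<subseteq> set e" "R \<subseteq> set e"
      and card: "card (set e - F) = 2" "card (set e - E) = 1" "card (set e - R) = 1"
      and d: "E \<subseteq> set d" "\<not> R \<subseteq> set d" and a: "F \<subseteq> set a" "\<not> E \<subseteq> set a" "\<not> R \<subseteq> set a"
      and unique: "\<forall>S \<in> set vertex_rows. R \<subseteq> set S \<longrightarrow> S = e"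
      and w: "w \<in> tight_face R" "w \<notin> tight_face E" for a d e F E R w
  proof -
    have less: "F \<subseteq> {..<8}" "E \<subseteq> {..<8}" "R \<subseteq> {..<8}"
      using rows_less[OF mem(2)] sub by auto
    note iff = less[THEN klee_walkup_vertex_in_tight_face_iff[rotated]]
    show ?thesis
    proof (rule two_steps[where d="klee_walkup_vertex d"])
      show "tight_face F face_of klee_walkup" "tight_face E face_of klee_walkup" "tight_face R face_of klee_walkup"
        using less by (simp_all add: tight_face_face_of)
      have "F \<subseteq> set e"
        using sub by blast
      then show "aff_dim (tight_face F) \<le> 2" "aff_dim (tight_face E) \<le> 1" "aff_dim (tight_face R) \<le> 1"
        using aff_dim_tight_face[OF mem(2)] sub card by (metis of_nat_numeral of_nat_1)+
      show "tight_face E \<subseteq> tight_face F" "tight_face R \<subseteq> tight_face F"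
        using sub by (simp_all add: tight_face_mono)
      show "\<not> tight_face R \<subseteq> tight_face E"
        using w by blast
      show "q = klee_walkup_vertex e" if q: "q extreme_point_of klee_walkup" "q \<in> tight_face R" for q
      proof -
        obtain S where S: "S \<in> set vertex_rows" "q = klee_walkup_vertex S"
          using klee_walkup_extreme_point[OF q(1)] by blast
        then have "R \<subseteq> set S"
          using q(2) iff(3) by simp
        then show ?thesis
          using unique S by simp
      qed
    qed (use mem sub d a in \<open>simp_all add: iff klee_walkup_vertex_extreme\<close>)
  qed
  \<comment> \<open>The vectors are second points on the two unbounded edges.\<close>
  have two1: "(?f [0, 1, 2, 3], ?f [0, 3, 5, 6]) \<in> steps ^^ 2"
    by (rule two[of _ _ "[0, 3, 6, 7]" "{0, 3}" "{0, 3, 6}" "{0, 3, 5}" "vector [1, 0, 7/3, 5]"])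
      (simp_all add: vertex_rows_code tight_face_def mem_klee_walkup all_less_8 klee_walkup_inner klee_walkup_rhs vector_4)
  have two2: "(?f [4, 5, 6, 7], ?f [0, 3, 4, 7]) \<in> steps ^^ 2"
    by (rule two[of _ _ "[2, 3, 4, 7]" "{4, 7}" "{3, 4, 7}" "{0, 4, 7}" "vector [0, 1/3, 2, 0]"])
      (simp_all add: vertex_rows_code tight_face_def mem_klee_walkup all_less_8 klee_walkup_inner klee_walkup_rhs vector_4)
  obtain q where q: "q extreme_point_of klee_walkup" "u = vert q"
    using extreme_point_vert[OF uv(1)] by blast
  obtain q' where q': "q' extreme_point_of klee_walkup" "v = vert q'"
    using extreme_point_vert[OF uv(2)] by blast
  obtain S where S: "S \<in> set vertex_rows" "u = ?f S"
    using klee_walkup_extreme_point[OF q(1)] q(2) by blast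
  obtain T where T: "T \<in> set vertex_rows" "v = ?f T"
    using klee_walkup_extreme_point[OF q'(1)] q'(2) by blast
  have "\<exists>j\<le>4. (u, v) \<in> steps ^^ j"
  proof (cases "T \<in> set (reachable 4 S)")
    case True
    then show ?thesis
      using reachable_relpow[where f="?f" and r=steps, OF S(1) edge] S(2) T(2) by blast
  next
    case False
    have "[0, 3, 5, 6] \<in> set vertex_rows" "[0, 3, 4, 7] \<in> set vertex_rows"
      by (simp_all add: vertex_rows_code)
    then obtain i j where "i \<le> 2" "(?f [0, 3, 5, 6], ?f [4, 5, 6, 7]) \<in> steps ^^ i"
        and "j \<le> 2" "(?f [0, 3, 4, 7], ?f [0, 1, 2, 3]) \<in> steps ^^ j"
      using reachable_relpow[where f="?f" and r=steps, OF _ edge reachable_exceptions(1)]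
        reachable_relpow[where f="?f" and r=steps, OF _ edge reachable_exceptions(2)] by blast
    with two1 two2 have "(?f [0, 1, 2, 3], ?f [4, 5, 6, 7]) \<in> steps ^^ (2 + i)" "2 + i \<le> 4"
        "(?f [4, 5, 6, 7], ?f [0, 1, 2, 3]) \<in> steps ^^ (2 + j)" "2 + j \<le> 4"
      unfolding relpow_add by auto
    moreover have "S = [0, 1, 2, 3] \<and> T = [4, 5, 6, 7] \<or> S = [4, 5, 6, 7] \<and> T = [0, 1, 2, 3]"
      using all_reach_others S(1) T(1) False by (auto simp: list_all_iff reaches_others_def)
    ultimately show ?thesis
      using S(2) T(2) by blast
  qed
  then obtain j where "j \<le> 4" "(u, v) \<in> steps ^^ j"
    by blast
  then have "circuit_distance A1 b1 A2 b2 u v \<le> enat j"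
    using circuit_distance_le unfolding P_def by blast
  also have "\<dots> \<le> 4"
    using \<open>j \<le> 4\<close> by (simp add: numeral_eq_enat)
  finally show ?thesis .
qed

theorem theorem3p1:
  fixes A1 A2 :: "(real ^ 'n) list" and b1 b2 :: "real list"
  assumes "length b1 = length A1" and "length b2 = length A2"
    and "rational_rows A1" and "rational_rows A2"
    and "combinatorially_equivalent (polyhedron_of A1 b1 A2 b2) klee_walkup"
  shows "circuit_diameter A1 b1 A2 b2 \<le> 4"
proof -
  obtain \<phi> where bij: "bij_betw \<phi> {F. F face_of polyhedron_of A1 b1 A2 b2} {G. G face_of klee_walkup}"
    and order: "\<forall>F F'. F face_of polyhedron_of A1 b1 A2 b2 \<longrightarrow> F' face_of polyhedron_of A1 b1 A2 b2 \<longrightarrow>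
      (F \<subseteq> F' \<longleftrightarrow> \<phi> F \<subseteq> \<phi> F')"
    using assms(5) unfolding combinatorially_equivalent_def by blast
  show ?thesis
    unfolding circuit_diameter_def
    using circuit_distance_le_4[OF assms(3,4) bij] order by (intro Sup_least) blast
qed

end
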